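(* Let $\mathcal{G}$ be a graph on $n$ vertices whose adjacency matrix $A$ has spectrum $\lambda_1,\lambda_2,\ldots,\lambda_n$ (eigenvalues listed with multiplicity), and let $k\in\mathbb{N}$. Then the spectrum of $\mathcal{G}^{\odot k}$ consists of the $\binom{n+k-1}{k}$ products $\lambda_{i_1}\lambda_{i_2}\cdots\lambda_{i_k}$ with $1\le i_1\le i_2\le\cdots\le i_k\le n$ (as a multiset); these are all of the eigenvalues of the adjacency matrix $A^{\odot k}$ of $\mathcal{G}^{\odot k}$.
   Context: $\mathbb{N}=\{1,2,\ldots\}$ and $[n]=\{1,\ldots,n\}$. The symmetric group $\mathfrak{S}_k$ acts on $[n]^k$ by permuting coordinates; $\operatorname{Orb}(\mathbf{i})$ is the orbit of $\mathbf{i}$ (the set of its distinct rearrangements). For $\mathbf{i}\in[n]^k$, $\mathbf{m}(\mathbf{i})=(m_1,\ldots,m_n)$ where $m_\ell$ is the number of occurrences of $\ell$ in $\mathbf{i}$, and $\binom{k}{\mathbf{m}(\mathbf{i})}=\frac{k!}{m_1!\cdots m_n!}$. Graphs are finite and undirected, loops are allowed, and edges may carry real weights ($\omega(v_p,v_q)=\omega(v_q,v_p)$, nonexistent edges have weight $0$; an unweighted graph has weights in $\{0,1\}$). The adjacency matrix is $[A]_{p,q}=\omega(v_p,v_q)$. For a graph $\mathcal{G}$ with vertices $v_1,\ldots,v_n$, the symmetric tensor power $\mathcal{G}^{\odot k}$ is the weighted graph whose vertices are the $\binom{n+k-1}{k}$ nondecreasing elements of $[n]^k$, with edge weights $$\omega^{\odot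 k}(\mathbf{i},\mathbf{j})=\frac{1}{\sqrt{\binom{k}{\mathbf{m}(\mathbf{i})}\binom{k}{\mathbf{m}(\mathbf{j})}}}\sum_{\mathbf{p}\in\operatorname{Orb}(\mathbf{i}),\ \mathbf{q}\in\operatorname{Orb}(\mathbf{j})}\ \prod_{\ell=1}^k\omega(v_{p_\ell},v_{q_\ell}).$$ Its adjacency matrix is denoted $A^{\odot k}$. The spectrum of a graph is the multiset of eigenvalues of its adjacency matrix. *)

theory Defs
  imports
    "Jordan_Normal_Form.Spectral_Radius"
    "HOL-Combinatorics.Permutations"
    "HOL-Combinatorics.List_Permutation"
begin

text \<open>
  A weighted graph with vertices v_1, ..., v_n is given by the list of its vertices and the
  weight function, with weight 0 for nonexistent edges; loops are allowed. Indices are shifted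
  by one throughout: v_p is \<open>verts G ! (p - 1)\<close>, and [n] becomes {0..<n}.
\<close>

record 'v weighted_graph =
  verts :: "'v list"
  weight :: "'v \<Rightarrow> 'v \<Rightarrow> real"

definition is_weighted_graph :: "'v weighted_graph \<Rightarrow> bool" where
  "is_weighted_graph G \<longleftrightarrow> distinct (verts G) \<and>
     (\<forall>u \<in> set (verts G). \<forall>v \<in> set (verts G). weight G u v = weight G v u)"

definition adjacency :: "'v weighted_graph \<Rightarrow> real mat" where
  "adjacency G = mat (length (verts G)) (length (verts G))
     (\<lambda>(p, q). weight G (verts G ! p) (verts G ! q))"

text \<open>
  Eigenvalues with algebraic multiplicity. The matrix is real symmetric, so all its complex
  eigenvalues are real and the algebraic and geometric multiplicities coincide.
\<close>

definition graph_spectrum :: "'v weighted_graph \<Rightarrow> real multiset" where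
  "graph_spectrum G = proots (char_poly (adjacency G))"

definition nondecreasing :: "nat \<Rightarrow> nat \<Rightarrow> nat list set" where
  "nondecreasing n k = {i. length i = k \<and> set i \<subseteq> {0..<n} \<and> sorted i}"

definition Orb :: "nat list \<Rightarrow> nat list set" where
  "Orb i = {permute_list \<sigma> i |\<sigma>. \<sigma> permutes {..<length i}}"

text \<open>The multinomial coefficient of the multiplicities of 0, ..., n - 1 in i.\<close>

definition multinom :: "nat \<Rightarrow> nat list \<Rightarrow> real" where
  "multinom n i = fact (length i) / (\<Prod>l = 0..<n. fact (count_list i l))"

text \<open>
  The vertices are the nondecreasing elements of {0..<n}^k, each listed once. Any other order
  of them gives an adjacency matrix that differs by a simultaneous permutation of rows and columns.
\<close>

definition sym_tensor_power :: "nat \<Rightarrow> 'v weighted_graph \<Rightarrow> nat list weighted_graph" where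
  "sym_tensor_power k G =
     (let n = length (verts G) in
      \<lparr> verts = filter sorted (List.n_lists k [0..<n]),
        weight = (\<lambda>i j.
          1 / sqrt (multinom n i * multinom n j) *
          (\<Sum>p \<in> Orb i. \<Sum>q \<in> Orb j. \<Prod>l = 0..<k. weight G (verts G ! (p ! l)) (verts G ! (q ! l)))) \<rparr>)"

lemma set_verts_sym_tensor_power:
  "set (verts (sym_tensor_power k G)) = nondecreasing (length (verts G)) k"
  by (auto simp: sym_tensor_power_def Let_def nondecreasing_def set_n_lists)

lemma in_Orb_iff: "p \<in> Orb i \<longleftrightarrow> mset p = mset i"
  unfolding Orb_def by (auto simp: mset_permute_list elim!: mset_eq_permutation)

lemma is_weighted_graph_sym_tensor_power:
  assumes "is_weighted_graph G"
  shows "is_weighted_graph (sym_tensor_power k G)"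
  unfolding is_weighted_graph_def
proof (intro conjI ballI)
  show "distinct (verts (sym_tensor_power k G))"
    by (simp add: sym_tensor_power_def Let_def distinct_n_lists)
next
  fix i j
  assume ij: "i \<in> set (verts (sym_tensor_power k G))" "j \<in> set (verts (sym_tensor_power k G))"
  let ?v = "\<lambda>a. verts G ! a"
  have bnd: "?v (p ! l) \<in> set (verts G)"
    if "i' \<in> nondecreasing (length (verts G)) k" "p \<in> Orb i'" "l < k" for i' p l
  proof -
    have m: "mset p = mset i'" using that(2) by (simp add: in_Orb_iff)
    have "length p = k" "set p \<subseteq> {0..<length (verts G)}"
      using that(1) mset_eq_length[OF m] mset_eq_setD[OF m] by (auto simp: nondecreasing_def)
    then have "p ! l < length (verts G)"
      using that(3) nth_mem[of l p] by (meson atLeastLessThan_iff subsetD)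
    then show ?thesis by simp
  qed
  have sym: "weight G (?v (p ! l)) (?v (q ! l)) = weight G (?v (q ! l)) (?v (p ! l))"
    if "p \<in> Orb i" "q \<in> Orb j" "l < k" for p q l
    using assms that ij bnd unfolding is_weighted_graph_def set_verts_sym_tensor_power by blast
  have "(\<Sum>p \<in> Orb i. \<Sum>q \<in> Orb j. \<Prod>l = 0..<k. weight G (?v (p ! l)) (?v (q ! l)))
      = (\<Sum>p \<in> Orb i. \<Sum>q \<in> Orb j. \<Prod>l = 0..<k. weight G (?v (q ! l)) (?v (p ! l)))"
    by (intro sum.cong prod.cong refl sym) auto
  also have "\<dots> = (\<Sum>q \<in> Orb j. \<Sum>p \<in> Orb i. \<Prod>l = 0..<k. weight G (?v (q ! l)) (?v (p ! l)))"
    by (rule sum.swap)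
  finally show "weight (sym_tensor_power k G) i j = weight (sym_tensor_power k G) j i"
    by (simp add: sym_tensor_power_def Let_def mult.commute)
qed

end

theory Submission
  imports Defs "HOL-Combinatorics.Multiset_Permutations"
begin

text \<open>The weights of the symmetric tensor power make sense for every square matrix, and with the
  normalisation by the orbit sizes the power is multiplicative and preserves the identity, so it
  preserves similarity. The adjacency matrix has a split characteristic polynomial, hence is similar
  to an upper triangular matrix with diagonal \<open>ev 0, \<dots>, ev (n - 1)\<close>. The symmetric power of an
  upper triangular matrix is again upper triangular once the index tuples are listed by increasing
  sum, and its diagonal entry at \<open>i\<close> is the product of the diagonal entries indexed by \<open>i\<close>.\<close>

section \<open>Nondecreasing tuples and their orbits\<close>

lemma finite_nondecreasing [simp]: "finite (nondecreasing n k)"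
  by (rule finite_subset[OF _ finite_lists_length_eq[of "{0..<n}" k]]) (auto simp: nondecreasing_def)

lemma nondecreasing_eq_if_mset_eq:
  assumes "i \<in> nondecreasing n k" "j \<in> nondecreasing n k" "mset i = mset j"
  shows "i = j"
  using assms properties_for_sort[of j i] by (simp add: nondecreasing_def sorted_sort_id)

text \<open>A nondecreasing tuple carries the same information as its multiset of entries, so
  multisets of size \<open>k\<close> over an \<open>n\<close>-element set are counted
  instead.\<close>

lemma card_nondecreasing: "card (nondecreasing n k) = (n + k - 1) choose k"
proof -
  have "bij_betw mset (nondecreasing n k) (multisets_of_size {0..<n} k)"
  proof (rule bij_betw_byWitness[where f' = sorted_list_of_multiset])
    show "\<forall>i\<in>nondecreasing n k. sorted_list_of_multiset (mset i) = i"
      by (auto simp: nondecreasing_def sorted_list_of_multiset_mset sorted_sort_id)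
    show "\<forall>M\<in>multisets_of_size {0..<n} k. mset (sorted_list_of_multiset M) = M"
      by simp
    show "mset ` nondecreasing n k \<subseteq> multisets_of_size {0..<n} k"
      by (auto simp: nondecreasing_def multisets_of_size_def)
    show "sorted_list_of_multiset ` multisets_of_size {0..<n} k \<subseteq> nondecreasing n k"
      by (auto simp: nondecreasing_def multisets_of_size_def simp flip: size_mset)
  qed
  then show ?thesis
    using bij_betw_same_card card_multisets_of_size[of "{0..<n}" k] by fastforce
qed

lemma Orb_eq_permutations_of_multiset: "Orb i = permutations_of_multiset (mset i)"
  by (auto simp: in_Orb_iff permutations_of_multiset_def)

lemma finite_Orb [simp]: "finite (Orb i)"
  by (simp add: Orb_eq_permutations_of_multiset)

lemma self_in_Orb [simp]: "i \<in> Orb i"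
  by (simp add: in_Orb_iff)

lemma Orb_nonempty [simp]: "Orb i \<noteq> {}"
  using self_in_Orb by blast

lemma length_Orb: "q \<in> Orb i \<Longrightarrow> length q = length i"
  by (metis in_Orb_iff mset_eq_length)

lemma permute_list_Orb:
  assumes "q \<in> Orb j" "\<sigma> permutes {..<length j}"
  shows "permute_list \<sigma> q \<in> Orb j"
  using assms length_Orb[OF assms(1)] mset_permute_list[of \<sigma> q] by (simp add: in_Orb_iff)

lemma nth_Orb_less:
  assumes "q \<in> Orb i" "set i \<subseteq> {0..<n}" "l < length i"
  shows "q ! l < n"
proof -
  have "set q = set i"
    using assms(1) mset_eq_setD in_Orb_iff by blast
  moreover have "q ! l \<in> set q"
    using assms length_Orb by (metis nth_mem)
  ultimately show ?thesis using assms(2) by auto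
qed

lemmas nth_less = nth_Orb_less[OF self_in_Orb]

text \<open>Values that do not occur contribute \<open>fact 0 = 1\<close>, which leaves the usual
  count of the rearrangements of a multiset. Thus the normalisation of the weights can be handled
  through orbit sizes alone.\<close>

lemma multinom_eq_card_Orb:
  assumes "set i \<subseteq> {0..<n}"
  shows "multinom n i = real (card (Orb i))"
proof -
  have "(\<Prod>l = 0..<n. fact (count_list i l)) = (\<Prod>l\<in>set i. fact (count_list i l) :: nat)"
    using assms by (intro prod.mono_neutral_right) (auto simp: count_list_0_iff)
  then have "card (Orb i) * (\<Prod>l = 0..<n. fact (count_list i l)) = (fact (length i) :: nat)"
    using card_permutations_of_multiset_aux[of "mset i"]
    by (simp add: Orb_eq_permutations_of_multiset count_mset)
  then have "real (card (Orb i)) * (\<Prod>l = 0..<n. fact (count_list i l)) = fact (length i)"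
    by (metis (mono_tags, lifting) of_nat_fact of_nat_mult of_nat_prod prod.cong)
  then show ?thesis
    by (simp add: multinom_def field_simps)
qed

section \<open>Orbit sums and their multiplicativity\<close>

text \<open>Distributivity, with the choice of one summand per factor encoded as a list. The
  induction splits off the first factor, so \<open>f\<close> must be arbitrary: the tail uses the
  shifted family.\<close>

lemma prod_sum_lists_length:
  fixes f :: "nat \<Rightarrow> 'b \<Rightarrow> 'a::comm_semiring_1"
  assumes "finite A"
  shows "(\<Prod>l<k. \<Sum>r\<in>A. f l r) = (\<Sum>rs\<in>{rs. set rs \<subseteq> A \<and> length rs = k}. \<Prod>l<k. f l (rs ! l))"
proof (induction k arbitrary: f)
  case 0
  have "{rs. set rs \<subseteq> A \<and> length rs = 0} = {[]}" by auto
  then show ?case by simp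
next
  case (Suc k)
  let ?L = "{rs. set rs \<subseteq> A \<and> length rs = k}"
  have "(\<Sum>rs\<in>{rs. set rs \<subseteq> A \<and> length rs = Suc k}. \<Prod>l<Suc k. f l (rs ! l))
      = (\<Sum>(rs, r)\<in>?L \<times> A. \<Prod>l<Suc k. f l ((r # rs) ! l))"
    unfolding lists_length_Suc_eq
    by (subst sum.reindex) (auto simp: inj_on_def case_prod_beta)
  also have "\<dots> = (\<Sum>rs\<in>?L. \<Sum>r\<in>A. f 0 r * (\<Prod>l<k. f (Suc l) (rs ! l)))"
    by (simp add: sum.cartesian_product prod.lessThan_Suc_shift del: prod.lessThan_Suc)
  also have "\<dots> = (\<Sum>r\<in>A. f 0 r) * (\<Sum>rs\<in>?L. \<Prod>l<k. f (Suc l) (rs ! l))"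
    by (simp add: sum_product sum.swap[of _ A])
  also have "\<dots> = (\<Prod>l<Suc k. \<Sum>r\<in>A. f l r)"
    by (simp add: Suc.IH prod.lessThan_Suc_shift del: prod.lessThan_Suc)
  finally show ?case by simp
qed

text \<open>Sorting maps each tuple to the only nondecreasing member of its orbit, so the fibres of
  \<open>sort\<close> are the orbits.\<close>

lemma sum_lists_length_by_orbits:
  "(\<Sum>r\<in>{r. set r \<subseteq> {0..<n} \<and> length r = k}. f r) = (\<Sum>s\<in>nondecreasing n k. \<Sum>r\<in>Orb s. f r)"
proof -
  let ?L = "{r. set r \<subseteq> {0..<n} \<and> length r = k}"
  have "sum f ?L = (\<Sum>s\<in>nondecreasing n k. sum f {r \<in> ?L. sort r = s})"
    using finite_lists_length_eq[of "{0..<n}" k]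
    by (intro sum.group[symmetric] finite_nondecreasing) (auto simp: nondecreasing_def)
  also have "{r \<in> ?L. sort r = s} = Orb s" if "s \<in> nondecreasing n k" for s
  proof -
    have "r \<in> ?L \<and> sort r = s \<longleftrightarrow> mset r = mset s" for r
    proof
      assume "mset r = mset s"
      moreover from this have "set r = set s" "length r = length s"
        by (rule mset_eq_setD, rule mset_eq_length)
      ultimately show "r \<in> ?L \<and> sort r = s"
        using that by (simp add: nondecreasing_def properties_for_sort)
    qed auto
    then show ?thesis by (auto simp: in_Orb_iff)
  qed
  then have "(\<Sum>s\<in>nondecreasing n k. sum f {r \<in> ?L. sort r = s}) = (\<Sum>s\<in>nondecreasing n k. sum f (Orb s))"
    by (intro sum.cong refl) simp
  finally show ?thesis .
qed

text \<open>For tuples of equal length with entries in range, this is the coefficient of the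
  monomial with index tuple \<open>j\<close> in the product of the linear forms given by the rows of
  \<open>M\<close> indexed by \<open>i\<close>. Only the column index is symmetrised, which makes
  the power multiplicative without any normalising factor.\<close>

definition orbit_sum :: "'a::comm_semiring_1 mat \<Rightarrow> nat list \<Rightarrow> nat list \<Rightarrow> 'a" where
  "orbit_sum M i j = (\<Sum>q\<in>Orb j. \<Prod>l<length i. M $$ (i ! l, q ! l))"

text \<open>Rearranging \<open>i\<close> and \<open>q\<close> by the same permutation only reorders
  the factors, and that permutation maps \<open>Orb j\<close> bijectively onto itself.\<close>

lemma orbit_sum_Orb:
  assumes "i' \<in> Orb i" "length j = length i"
  shows "orbit_sum M i' j = orbit_sum M i j"
proof -
  obtain \<sigma> where \<sigma>: "\<sigma> permutes {..<length i}" and i': "i' = permute_list \<sigma> i"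
    using assms(1) unfolding Orb_def by auto
  have bij: "bij_betw (permute_list \<sigma>) (Orb j) (Orb j)"
  proof (rule bij_betw_byWitness[where f' = "permute_list (inv_into UNIV \<sigma>)"])
    note inv = permutes_inv[OF \<sigma>]
    show "\<forall>q\<in>Orb j. permute_list (inv_into UNIV \<sigma>) (permute_list \<sigma> q) = q"
      using inv \<sigma> assms(2) length_Orb
      by (metis permute_list_compose permute_list_id permutes_inv_o(1))
    show "\<forall>q\<in>Orb j. permute_list \<sigma> (permute_list (inv_into UNIV \<sigma>) q) = q"
      using inv \<sigma> assms(2) length_Orb
      by (metis permute_list_compose permute_list_id permutes_inv_o(2))
    show "permute_list \<sigma> ` Orb j \<subseteq> Orb j" "permute_list (inv_into UNIV \<sigma>) ` Orb j \<subseteq> Orb j"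
      using permute_list_Orb inv \<sigma> assms(2) by auto
  qed
  have "orbit_sum M i' j = (\<Sum>q\<in>Orb j. \<Prod>l<length i. M $$ (i' ! l, permute_list \<sigma> q ! l))"
    using sum.reindex_bij_betw[OF bij, of "\<lambda>q. \<Prod>l<length i. M $$ (i' ! l, q ! l)"]
    by (simp add: orbit_sum_def i')
  also have "\<dots> = (\<Sum>q\<in>Orb j. \<Prod>l<length i. M $$ (i ! \<sigma> l, q ! \<sigma> l))"
    using \<sigma> assms(2) by (intro sum.cong prod.cong refl) (simp add: i' permute_list_nth length_Orb)
  also have "\<dots> = orbit_sum M i j"
    unfolding orbit_sum_def
  proof (rule sum.cong[OF refl])
    fix q
    show "(\<Prod>l<length i. M $$ (i ! \<sigma> l, q ! \<sigma> l)) = (\<Prod>l<length i. M $$ (i ! l, q ! l))"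
      using prod.permute[OF \<sigma>, of "\<lambda>l. M $$ (i ! l, q ! l)"] by (simp add: comp_def)
  qed
  finally show ?thesis .
qed

text \<open>Expanding the entries of \<open>M * N\<close> gives a sum over all intermediate tuples
  \<open>r\<close>. Grouped by orbits, the factor from \<open>N\<close> is constant on each
  \<open>Orb s\<close>, while the factor from \<open>M\<close> sums to
  \<open>orbit_sum M i s\<close>.\<close>

lemma orbit_sum_mult:
  fixes M N :: "'a::comm_semiring_1 mat"
  assumes M: "M \<in> carrier_mat n n" and N: "N \<in> carrier_mat n n"
    and i: "set i \<subseteq> {0..<n}" "length i = k" and j: "set j \<subseteq> {0..<n}" "length j = k"
  shows "orbit_sum (M * N) i j = (\<Sum>s\<in>nondecreasing n k. orbit_sum M i s * orbit_sum N s j)"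
proof -
  let ?L = "{r. set r \<subseteq> {0..<n} \<and> length r = k}"
  have entry: "(M * N) $$ (i ! l, q ! l) = (\<Sum>r = 0..<n. M $$ (i ! l, r) * N $$ (r, q ! l))"
    if "q \<in> Orb j" "l < k" for q l
  proof -
    have "i ! l < n" "q ! l < n"
      using i j that nth_less[OF i(1)] nth_Orb_less[OF that(1) j(1)] by auto
    then show ?thesis
      using M N by (simp add: scalar_prod_def)
  qed
  have "orbit_sum (M * N) i j
      = (\<Sum>q\<in>Orb j. \<Prod>l<k. \<Sum>r = 0..<n. M $$ (i ! l, r) * N $$ (r, q ! l))"
    unfolding orbit_sum_def i by (intro sum.cong prod.cong refl entry) auto
  also have "\<dots> = (\<Sum>q\<in>Orb j. \<Sum>r\<in>?L. \<Prod>l<k. M $$ (i ! l, r ! l) * N $$ (r ! l, q ! l))"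
    by (simp add: prod_sum_lists_length)
  also have "\<dots> = (\<Sum>r\<in>?L. (\<Prod>l<k. M $$ (i ! l, r ! l)) * orbit_sum N r j)"
    by (subst sum.swap) (simp add: orbit_sum_def prod.distrib sum_distrib_left)
  also have "\<dots> = (\<Sum>s\<in>nondecreasing n k. \<Sum>r\<in>Orb s. (\<Prod>l<k. M $$ (i ! l, r ! l)) * orbit_sum N r j)"
    by (rule sum_lists_length_by_orbits)
  also have "\<dots> = (\<Sum>s\<in>nondecreasing n k. \<Sum>r\<in>Orb s. (\<Prod>l<k. M $$ (i ! l, r ! l)) * orbit_sum N s j)"
    using j by (intro sum.cong refl) (simp add: orbit_sum_Orb nondecreasing_def)
  also have "\<dots> = (\<Sum>s\<in>nondecreasing n k. orbit_sum M i s * orbit_sum N s j)"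
    using i by (simp add: orbit_sum_def sum_distrib_right)
  finally show ?thesis .
qed

lemma orbit_sum_one:
  assumes "i \<in> nondecreasing n k" "j \<in> nondecreasing n k"
  shows "orbit_sum (1\<^sub>m n) i j = (if i = j then 1 else 0)"
proof -
  have i: "length i = k" "set i \<subseteq> {0..<n}" and j: "length j = k" "set j \<subseteq> {0..<n}"
    using assms by (auto simp: nondecreasing_def)
  have "(\<Prod>l<length i. 1\<^sub>m n $$ (i ! l, q ! l)) = (if q = i then 1 else 0 :: 'a)" if "q \<in> Orb j" for q
  proof -
    have q: "length q = k"
      using that j length_Orb by blast
    have "1\<^sub>m n $$ (i ! l, q ! l) = (if q ! l = i ! l then 1 else 0 :: 'a)" if "l < k" for l
      using i j that nth_less[OF i(2), of l] nth_Orb_less[OF \<open>q \<in> Orb j\<close> j(2), of l] by simp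
    then have "(\<Prod>l<length i. 1\<^sub>m n $$ (i ! l, q ! l))
        = (\<Prod>l<k. if q ! l = i ! l then 1 else 0 :: 'a)"
      using i by (intro prod.cong) auto
    \<comment> \<open>If \<open>q\<close> differs from \<open>i\<close> at some position, the factor
      there is zero.\<close>
    also have "\<dots> = (if q = i then 1 else 0)"
      using i q by (auto simp: list_eq_iff_nth_eq intro!: prod_zero)
    finally show ?thesis .
  qed
  then have "orbit_sum (1\<^sub>m n) i j = (\<Sum>q\<in>Orb j. if q = i then 1 else 0 :: 'a)"
    unfolding orbit_sum_def by (intro sum.cong refl)
  also have "\<dots> = (if i \<in> Orb j then 1 else 0)"
    by simp
  also have "i \<in> Orb j \<longleftrightarrow> i = j"
    using nondecreasing_eq_if_mset_eq[OF assms] by (auto simp: in_Orb_iff)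
  finally show ?thesis .
qed

section \<open>Normalised symmetric powers of matrices\<close>

text \<open>Rows and columns are listed independently because the eigenvalues are read off in an order
  different from the given one; changing the order is then a multiplication of such matrices.\<close>

definition sym_power_mat :: "real mat \<Rightarrow> nat list list \<Rightarrow> nat list list \<Rightarrow> real mat" where
  "sym_power_mat M vs ws = mat (length vs) (length ws)
     (\<lambda>(a, b). sqrt (card (Orb (vs ! a)) / card (Orb (ws ! b))) * orbit_sum M (vs ! a) (ws ! b))"

lemma sym_power_mat_carrier [simp]:
  "sym_power_mat M vs ws \<in> carrier_mat (length vs) (length ws)"
  by (simp add: sym_power_mat_def)

text \<open>The normalisation rescales row \<open>i\<close> by the root of its orbit size and column
  \<open>j\<close> by the inverse root, so the factors belonging to the intermediate index
  cancel.\<close>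

lemma sym_power_mat_mult:
  assumes "M \<in> carrier_mat n n" "N \<in> carrier_mat n n"
    and "set vs \<subseteq> nondecreasing n k" "set us \<subseteq> nondecreasing n k"
    and ws: "distinct ws" "set ws = nondecreasing n k"
  shows "sym_power_mat M vs ws * sym_power_mat N ws us = sym_power_mat (M * N) vs us"
proof (rule eq_matI)
  fix a b
  assume "a < dim_row (sym_power_mat (M * N) vs us)" "b < dim_col (sym_power_mat (M * N) vs us)"
  then have a: "a < length vs" and b: "b < length us"
    by (auto simp: sym_power_mat_def)
  let ?i = "vs ! a" and ?j = "us ! b"
  have i: "?i \<in> nondecreasing n k" and j: "?j \<in> nondecreasing n k"
    using assms(3,4) a b nth_mem by blast+
  have bij: "bij_betw ((!) ws) {0..<length ws} (nondecreasing n k)"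
    using bij_betw_nth[OF ws(1), of "{0..<length ws}" "set ws"] ws(2) by (simp add: atLeast0LessThan)
  let ?c = "\<lambda>i. real (card (Orb i))"
  have "(sym_power_mat M vs ws * sym_power_mat N ws us) $$ (a, b)
      = (\<Sum>c = 0..<length ws. sqrt (?c ?i / ?c (ws ! c)) * orbit_sum M ?i (ws ! c)
          * (sqrt (?c (ws ! c) / ?c ?j) * orbit_sum N (ws ! c) ?j))"
    using a b by (simp add: sym_power_mat_def scalar_prod_def)
  also have "\<dots> = (\<Sum>s\<in>nondecreasing n k. sqrt (?c ?i / ?c s) * orbit_sum M ?i s
          * (sqrt (?c s / ?c ?j) * orbit_sum N s ?j))"
    by (rule sum.reindex_bij_betw[OF bij])
  also have "\<dots> = (\<Sum>s\<in>nondecreasing n k. sqrt (?c ?i / ?c ?j) * (orbit_sum M ?i s * orbit_sum N s ?j))"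
    \<comment> \<open>The cancellation divides by the root of the size of \<open>Orb s\<close>,
      which is nonzero because orbits are finite and nonempty.\<close>
    by (intro sum.cong refl) (simp add: real_sqrt_divide field_simps)
  also have "\<dots> = sqrt (?c ?i / ?c ?j) * orbit_sum (M * N) ?i ?j"
    using assms i j by (subst orbit_sum_mult[of _ n _ _ k]) (auto simp: nondecreasing_def sum_distrib_left)
  also have "\<dots> = sym_power_mat (M * N) vs us $$ (a, b)"
    using a b by (simp add: sym_power_mat_def)
  finally show "(sym_power_mat M vs ws * sym_power_mat N ws us) $$ (a, b)
    = sym_power_mat (M * N) vs us $$ (a, b)" .
qed (simp_all add: sym_power_mat_def)

lemma sym_power_mat_one:
  assumes "distinct vs" "set vs \<subseteq> nondecreasing n k"
  shows "sym_power_mat (1\<^sub>m n) vs vs = 1\<^sub>m (length vs)"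
proof (rule eq_matI)
  fix a b
  assume "a < dim_row (1\<^sub>m (length vs) :: real mat)" "b < dim_col (1\<^sub>m (length vs) :: real mat)"
  then have ab: "a < length vs" "b < length vs"
    by auto
  then have "vs ! a \<in> nondecreasing n k" "vs ! b \<in> nondecreasing n k"
    using assms(2) nth_mem by blast+
  then show "sym_power_mat (1\<^sub>m n) vs vs $$ (a, b) = 1\<^sub>m (length vs) $$ (a, b)"
    using assms(1) ab by (auto simp: orbit_sum_one sym_power_mat_def nth_eq_iff_index_eq)
qed (simp_all add: sym_power_mat_def)

text \<open>The powers of \<open>P\<close> and \<open>Q\<close> are the transforming matrices.
  Taking their rows and columns in the two different orders makes them perform the reordering from
  \<open>vs\<close> to \<open>ws\<close> as well.\<close>

lemma similar_mat_sym_power_mat: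
  assumes sim: "similar_mat_wit A B P Q" and A: "A \<in> carrier_mat n n"
    and vs: "distinct vs" "set vs = nondecreasing n k"
    and ws: "distinct ws" "set ws = nondecreasing n k"
  shows "similar_mat (sym_power_mat A vs vs) (sym_power_mat B ws ws)"
proof (rule similar_matI)
  note wit = similar_mat_witD2[OF A sim]
  have len: "length ws = length vs"
    using vs ws by (metis distinct_card)
  have *: "set vs \<subseteq> nondecreasing n k" "set ws \<subseteq> nondecreasing n k"
    using vs ws by auto
  show "{sym_power_mat A vs vs, sym_power_mat B ws ws, sym_power_mat P vs ws, sym_power_mat Q ws vs}
      \<subseteq> carrier_mat (length vs) (length vs)"
    using len sym_power_mat_carrier by (metis empty_subsetI insert_subset)
  show "sym_power_mat P vs ws * sym_power_mat Q ws vs = 1\<^sub>m (length vs)"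
    using sym_power_mat_mult[OF wit(6,7) *(1,1) ws] sym_power_mat_one[OF vs(1) *(1)] wit(1) by simp
  show "sym_power_mat Q ws vs * sym_power_mat P vs ws = 1\<^sub>m (length vs)"
    using sym_power_mat_mult[OF wit(7,6) *(2,2) vs] sym_power_mat_one[OF ws(1) *(2)] wit(2) len by simp
  show "sym_power_mat A vs vs = sym_power_mat P vs ws * sym_power_mat B ws ws * sym_power_mat Q ws vs"
    using sym_power_mat_mult[OF wit(6,5) * ws] sym_power_mat_mult[OF _ wit(7) *(1,1) ws, of "P * B"] wit
    by simp
qed

section \<open>Symmetric powers of upper triangular matrices\<close>

text \<open>A nonzero product requires \<open>q\<close> to dominate \<open>i\<close> entrywise.
  Since \<open>q\<close> has the sum of \<open>j\<close>, which is at most that of \<open>i\<close>,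
  this forces \<open>q = i\<close>.\<close>

lemma orbit_sum_upper_triangular:
  assumes B: "B \<in> carrier_mat n n" "upper_triangular B"
    and i: "i \<in> nondecreasing n k" and j: "j \<in> nondecreasing n k" and le: "sum_list j \<le> sum_list i"
  shows "orbit_sum B i j = (if i = j then \<Prod>l<k. B $$ (i ! l, i ! l) else 0)"
proof -
  have len: "length i = k" "length j = k" and sub: "set i \<subseteq> {0..<n}"
    using i j by (auto simp: nondecreasing_def)
  have "(\<Prod>l<k. B $$ (i ! l, q ! l)) = (if q = i then \<Prod>l<k. B $$ (i ! l, i ! l) else 0)"
    if q: "q \<in> Orb j" for q
  proof (cases "\<forall>l<k. i ! l \<le> q ! l")
    case True
    have lq: "length q = k"
      using q len length_Orb by simp
    have "sum_list q = sum_list j"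
      using q in_Orb_iff sum_mset_sum_list by metis
    then have "(\<Sum>l<k. q ! l) \<le> (\<Sum>l<k. i ! l)"
      using le len lq by (simp add: sum_list_sum_nth atLeast0LessThan)
    \<comment> \<open>One strict inequality would make the sum of \<open>q\<close> exceed that of
      \<open>i\<close>.\<close>
    then have "i ! l = q ! l" if "l < k" for l
      using that True sum_strict_mono_ex1[of "{..<k}" "(!) i" "(!) q"] by force
    then have "q = i"
      using lq len by (simp add: list_eq_iff_nth_eq)
    then show ?thesis by simp
  next
    case False
    then obtain l where l: "l < k" "q ! l < i ! l" by auto
    then have "i ! l < n"
      using len nth_less[OF sub] by simp
    \<comment> \<open>This entry lies strictly below the diagonal of \<open>B\<close>.\<close>
    then have "B $$ (i ! l, q ! l) = 0"
      using B l by auto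
    then show ?thesis
      using l by (auto intro!: prod_zero)
  qed
  then have "orbit_sum B i j = (\<Sum>q\<in>Orb j. if q = i then \<Prod>l<k. B $$ (i ! l, i ! l) else 0)"
    unfolding orbit_sum_def len by (intro sum.cong refl)
  also have "\<dots> = (if i \<in> Orb j then \<Prod>l<k. B $$ (i ! l, i ! l) else 0)"
    by simp
  also have "i \<in> Orb j \<longleftrightarrow> i = j"
    using nondecreasing_eq_if_mset_eq[OF i j] by (auto simp: in_Orb_iff)
  finally show ?thesis .
qed

text \<open>Listing by increasing sum places the vanishing orbit sums below the diagonal. Ties may
  be broken arbitrarily, since entries between distinct tuples of equal sum vanish in both
  directions. On the diagonal the normalising factor is 1.\<close>

lemma char_poly_sym_power_mat_upper_triangular:
  assumes B: "B \<in> carrier_mat n n" "upper_triangular B"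
    and ws: "distinct ws" "set ws = nondecreasing n k" "sorted (map sum_list ws)"
  shows "char_poly (sym_power_mat B ws ws) = (\<Prod>i\<leftarrow>ws. [:- (\<Prod>l<k. B $$ (i ! l, i ! l)), 1:])"
proof -
  have entry: "sym_power_mat B ws ws $$ (a, b) = (if a = b then \<Prod>l<k. B $$ (ws ! a ! l, ws ! a ! l) else 0)"
    if "b \<le> a" "a < length ws" for a b
  proof -
    have "sum_list (ws ! b) \<le> sum_list (ws ! a)"
      using sorted_nth_mono[OF ws(3) that(1)] that by simp
    then show ?thesis
      using that ws(1,2) orbit_sum_upper_triangular[OF B, of "ws ! a" k "ws ! b"]
        nth_mem[of a ws] nth_mem[of b ws]
      by (auto simp: sym_power_mat_def nth_eq_iff_index_eq)
  qed
  then have "upper_triangular (sym_power_mat B ws ws)"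
    by (auto simp: sym_power_mat_def)
  moreover have "diag_mat (sym_power_mat B ws ws) = map (\<lambda>i. \<Prod>l<k. B $$ (i ! l, i ! l)) ws"
  proof (rule nth_equalityI)
    show len: "length (diag_mat (sym_power_mat B ws ws)) = length (map (\<lambda>i. \<Prod>l<k. B $$ (i ! l, i ! l)) ws)"
      by (simp add: diag_mat_def sym_power_mat_def)
    fix a
    assume "a < length (diag_mat (sym_power_mat B ws ws))"
    then have "a < length ws"
      using len by simp
    moreover from this have "diag_mat (sym_power_mat B ws ws) ! a = sym_power_mat B ws ws $$ (a, a)"
      using carrier_matD(1)[OF sym_power_mat_carrier[of B ws ws]] by (simp add: diag_mat_def)
    ultimately show "diag_mat (sym_power_mat B ws ws) ! a = map (\<lambda>i. \<Prod>l<k. B $$ (i ! l, i ! l)) ws ! a"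
      using entry[of a a] by simp
  qed
  ultimately show ?thesis
    using char_poly_upper_triangular[OF sym_power_mat_carrier] by (simp add: comp_def)
qed

section \<open>The adjacency matrix of the symmetric tensor power\<close>

text \<open>The inner sum is the same for every \<open>p\<close> in \<open>Orb ?i\<close>, so the
  outer sum contributes the factor \<open>?c ?i\<close>. Together with the symmetric normalisation
  this becomes the root of the quotient of the orbit sizes.\<close>

lemma adjacency_sym_tensor_power:
  fixes G :: "'v weighted_graph" and n k :: nat
  assumes "length (verts G) = n"
  defines "vs \<equiv> verts (sym_tensor_power k G)"
  shows "adjacency (sym_tensor_power k G) = sym_power_mat (adjacency G) vs vs"
proof (rule eq_matI)
  fix a b
  assume "a < dim_row (sym_power_mat (adjacency G) vs vs)" "b < dim_col (sym_power_mat (adjacency G) vs vs)"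
  then have a: "a < length vs" and b: "b < length vs"
    by (auto simp: sym_power_mat_def)
  let ?i = "vs ! a" and ?j = "vs ! b" and ?c = "\<lambda>i. real (card (Orb i))"
  let ?w = "\<lambda>p q. weight G (verts G ! p) (verts G ! q)"
  have "set vs = nondecreasing n k"
    using assms set_verts_sym_tensor_power by blast
  then have i: "length ?i = k" "set ?i \<subseteq> {0..<n}" and j: "length ?j = k" "set ?j \<subseteq> {0..<n}"
    using a b nth_mem[of a vs] nth_mem[of b vs] by (auto simp: nondecreasing_def)
  have "(\<Sum>q\<in>Orb ?j. \<Prod>l = 0..<k. ?w (p ! l) (q ! l)) = orbit_sum (adjacency G) ?i ?j"
    if p: "p \<in> Orb ?i" for p
  proof -
    have "(\<Sum>q\<in>Orb ?j. \<Prod>l = 0..<k. ?w (p ! l) (q ! l)) = orbit_sum (adjacency G) p ?j"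
      unfolding orbit_sum_def length_Orb[OF p] i(1) atLeast0LessThan
      using assms(1) nth_Orb_less[OF p i(2)] nth_Orb_less[OF _ j(2)] i(1) j(1)
      by (intro sum.cong prod.cong refl) (auto simp: adjacency_def)
    then show ?thesis
      using orbit_sum_Orb[OF p] i j by simp
  qed
  then have "(\<Sum>p\<in>Orb ?i. \<Sum>q\<in>Orb ?j. \<Prod>l = 0..<k. ?w (p ! l) (q ! l)) = ?c ?i * orbit_sum (adjacency G) ?i ?j"
    by simp
  moreover have "1 / sqrt (?c ?i * ?c ?j) * (?c ?i * x) = sqrt (?c ?i / ?c ?j) * x" for x
  proof -
    have "?c ?i = sqrt (?c ?i) * sqrt (?c ?i)" by simp
    then show ?thesis
      by (simp add: real_sqrt_divide real_sqrt_mult field_simps)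
  qed
  moreover have "adjacency (sym_tensor_power k G) $$ (a, b)
      = 1 / sqrt (multinom n ?i * multinom n ?j) *
        (\<Sum>p\<in>Orb ?i. \<Sum>q\<in>Orb ?j. \<Prod>l = 0..<k. ?w (p ! l) (q ! l))"
    using a b assms(1) by (simp add: adjacency_def sym_tensor_power_def vs_def Let_def)
  ultimately show "adjacency (sym_tensor_power k G) $$ (a, b) = sym_power_mat (adjacency G) vs vs $$ (a, b)"
    using a b i j by (simp add: multinom_eq_card_Orb sym_power_mat_def)
qed (simp_all add: adjacency_def sym_power_mat_def vs_def)

section \<open>Polynomials that split into linear factors\<close>

lemma proots_prod_list_linear: "proots (\<Prod>x\<leftarrow>xs. [:- f x, 1:]) = image_mset f (mset xs)"
  for f :: "'b \<Rightarrow> 'a::idom"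
  by (induction xs) (simp_all add: proots_mult prod_list_zero_iff image_iff del: mult_pCons_left)

text \<open>Dividing out the linear factor of one root lowers both the degree and the number of
  roots by one, so the quotient meets the same assumptions. This yields the factorisation that
  \<open>schur_decomposition\<close> takes as input.\<close>

lemma split_if_size_proots_eq_degree:
  fixes p :: "'a::idom poly"
  assumes "lead_coeff p = 1" "size (proots p) = degree p" "mset xs = proots p"
  shows "p = (\<Prod>x\<leftarrow>xs. [:- x, 1:])"
  using assms
proof (induction xs arbitrary: p)
  case Nil
  then have "degree p = 0" by simp
  then show ?case
    using Nil.prems(1) by (auto elim!: degree_eq_zeroE)
next
  case (Cons x xs)
  have p: "p \<noteq> 0" using Cons.prems(1) by auto
  then have "poly p x = 0"
    using set_count_proots[OF p] unfolding Cons.prems(3)[symmetric] by auto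
  then obtain r where r: "p = [:- x, 1:] * r"
    by (auto simp: poly_eq_0_iff_dvd)
  have "r \<noteq> 0" using p r by auto
  then have "proots p = add_mset x (proots r)" "degree p = Suc (degree r)"
    unfolding r by (simp_all add: proots_mult degree_mult_eq del: mult_pCons_left)
  moreover have "lead_coeff p = lead_coeff r"
    unfolding r lead_coeff_mult by simp
  ultimately have "r = (\<Prod>x\<leftarrow>xs. [:- x, 1:])"
    using Cons.prems by (intro Cons.IH) (auto)
  then show ?case using r by simp
qed

section \<open>The spectrum of the symmetric tensor power\<close>

theorem theorem4p1:
  fixes G :: "'v weighted_graph" and n k :: nat and ev :: "nat \<Rightarrow> real"
  assumes "is_weighted_graph G"
    and "length (verts G) = n"
    and "graph_spectrum G = image_mset ev (mset_set {0..<n})"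
    and "k \<ge> 1"
  shows "graph_spectrum (sym_tensor_power k G) =
           image_mset (\<lambda>i. \<Prod>l = 0..<k. ev (i ! l)) (mset_set (nondecreasing n k)) \<and>
         card (nondecreasing n k) = (n + k - 1) choose k \<and>
         adjacency (sym_tensor_power k G) \<in>
           carrier_mat ((n + k - 1) choose k) ((n + k - 1) choose k) \<and>
         spectrum (adjacency (sym_tensor_power k G)) =
           (\<lambda>i. \<Prod>l = 0..<k. ev (i ! l)) ` nondecreasing n k"
proof -
  define A where "A = adjacency G"
  define es where "es = map ev [0..<n]"
  define vs where "vs = verts (sym_tensor_power k G)"
  \<comment> \<open>The adjacency matrix uses the order \<open>vs\<close>; triangularity is
    available in the order \<open>ws\<close>.\<close>
  define ws where "ws = sort_key sum_list vs"
  let ?S = "adjacency (sym_tensor_power k G)" and ?f = "\<lambda>i. \<Prod>l = 0..<k. ev (i ! l)"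
  have vs: "distinct vs" "set vs = nondecreasing n k"
    using is_weighted_graph_sym_tensor_power[OF assms(1)] assms(2) set_verts_sym_tensor_power
    unfolding vs_def is_weighted_graph_def by blast+
  have ws: "distinct ws" "set ws = nondecreasing n k" "sorted (map sum_list ws)"
    using vs by (simp_all add: ws_def)
  have A: "A \<in> carrier_mat n n"
    using assms(2) by (simp add: A_def adjacency_def)
  have "mset es = proots (char_poly A)"
    using assms(3) by (simp add: es_def A_def graph_spectrum_def)
  moreover have "degree (char_poly A) = n" "lead_coeff (char_poly A) = 1"
    using degree_monic_char_poly[OF A] by auto
  \<comment> \<open>The given spectrum supplies \<open>n\<close> real roots counted with
    multiplicity, as many as the degree, so the characteristic polynomial splits over the
    reals.\<close>
  moreover have "size (proots (char_poly A)) = n"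
    using assms(3) by (simp add: A_def graph_spectrum_def)
  ultimately have split: "char_poly A = (\<Prod>e\<leftarrow>es. [:- e, 1:])"
    by (intro split_if_size_proots_eq_degree) auto
  obtain B P Q where "schur_decomposition A es = (B, P, Q)"
    by (metis prod_cases3)
  from schur_decomposition[OF A split this]
  have sim: "similar_mat_wit A B P Q" and B: "upper_triangular B" "diag_mat B = es"
    by auto
  have Bc: "B \<in> carrier_mat n n"
    using similar_mat_witD2[OF A sim] by blast
  \<comment> \<open>The decomposition keeps the order of \<open>es\<close> on the diagonal, so
    position \<open>l\<close> carries exactly \<open>ev l\<close>.\<close>
  have diag: "B $$ (l, l) = ev l" if "l < n" for l
    using arg_cong[OF B(2), of "\<lambda>xs. xs ! l"] that Bc by (simp add: diag_mat_def es_def)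
  have "?S = sym_power_mat A vs vs"
    using adjacency_sym_tensor_power[OF assms(2)] by (simp add: A_def vs_def)
  then have "char_poly ?S = (\<Prod>i\<leftarrow>ws. [:- (\<Prod>l<k. B $$ (i ! l, i ! l)), 1:])"
    using char_poly_similar[OF similar_mat_sym_power_mat[OF sim A vs ws(1,2)]]
      char_poly_sym_power_mat_upper_triangular[OF Bc B(1) ws] by simp
  also have "\<dots> = (\<Prod>i\<leftarrow>ws. [:- ?f i, 1:])"
  proof -
    have "(\<Prod>l<k. B $$ (i ! l, i ! l)) = ?f i" if "i \<in> set ws" for i
      unfolding atLeast0LessThan
    proof (intro prod.cong refl diag)
      fix l assume "l \<in> {..<k}"
      then show "i ! l < n"
        using that ws(2) nth_less[of i n l] by (simp add: nondecreasing_def)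
    qed
    then show ?thesis by (simp cong: map_cong)
  qed
  finally have "graph_spectrum (sym_tensor_power k G) = image_mset ?f (mset ws)"
    by (simp add: graph_spectrum_def proots_prod_list_linear)
  moreover have "mset ws = mset_set (nondecreasing n k)"
    using ws mset_set_set by metis
  ultimately have spec: "graph_spectrum (sym_tensor_power k G) = image_mset ?f (mset_set (nondecreasing n k))"
    by simp
  have "length vs = (n + k - 1) choose k"
    using vs card_nondecreasing distinct_card by metis
  then have S: "?S \<in> carrier_mat ((n + k - 1) choose k) ((n + k - 1) choose k)"
    by (simp add: adjacency_def vs_def)
  \<comment> \<open>Only for a nonzero polynomial is the underlying set of \<open>proots\<close> the
    set of all roots.\<close>
  have "char_poly ?S \<noteq> 0"
    using degree_monic_char_poly[OF S] by auto
  then have "spectrum ?S = set_mset (proots (char_poly ?S))"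
    unfolding spectrum_def eigenvalue_root_char_poly[OF S] by simp
  also have "\<dots> = ?f ` nondecreasing n k"
    using spec unfolding graph_spectrum_def by simp
  finally show ?thesis
    using spec card_nondecreasing S by blast
qed

end
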